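(* Let $A$ be an approximately unital Banach algebra whose hermitian idempotents are ultrahermitian and commute with each other. Let $(a_n)_{n\in\mathbb{N}}$ be a sequence in $A_{\mathrm{MP}}$ that converges in norm to $a\in A_{\mathrm{MP}}$. Then the following are equivalent: (1) $a_n^\dagger\to a^\dagger$. (2) $\sup_{n\in\mathbb{N}}\|a_n^\dagger\|<\infty$. (3) $a_n^\dagger a_n\to a^\dagger a$ and $a_na_n^\dagger\to aa^\dagger$.
   Context: Banach algebras are complex; a unital Banach algebra has a contractive unit. $A_1$ denotes the set of contractive elements ($\|a\|\le1$). $A$ is approximately unital if there is a net $(e_j)$ in $A_1$ with $ae_j\to a$ and $e_ja\to a$ for all $a\in A$. The minimal multiplier unitization $\widetilde{A}$ is $A$ itself if $A$ is unital, and otherwise $\widetilde{A}=A+\mathbb{C}1$ with norm $\|a+\mu1\|=\sup_{b\in A_1}\|ab+\mu b\|$; $A$ embeds isometrically as a closed two-sided ideal. An element $a$ of a unital Banach algebra is hermitian if $\|\exp(ita)\|=1$ for all $t\in\mathbb{R}$; an element of an approximately unital $A$ is hermitian if it is hermitian in $\widetilde{A}$. $A_{\mathrm{h}}$ is the set of hermitian elements. An idempotent $e$ in a unital Banach algebra $B$ is ultrahermitian if $\|eae+(1-e)b(1-e)\|\le1$ for all $a,b\in B_1$; an idempotent in an approximately unital $A$ is ultrahermitian if it is so in $\widetilde{A}$. An element $a\in A$ is Moore-Penrose invertible if there is $b\in A$ with $a=aba$, $b=bab$ and $ab,ba\in A_{\mathrm{h}}$; such $b$ is unique and denoted $a^\dagger$.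 $A_{\mathrm{MP}}$ is the set of Moore-Penrose invertible elements of $A$. All convergence is in norm. *)

theory Defs
  imports "HOL-Analysis.Analysis"
begin

section \<open>Complex Banach algebras, possibly without unit\<close>

text \<open>The norm of \<^class>\<open>real_normed_algebra\<close> is submultiplicative, and no unit is assumed;
  in particular the zero algebra is allowed.\<close>

class complex_banach_algebra = real_normed_algebra + banach +
  fixes scaleC :: "complex \<Rightarrow> 'a \<Rightarrow> 'a"  (infixr \<open>*\<^sub>C\<close> 75)
  assumes scaleC_add_right: "c *\<^sub>C (x + y) = c *\<^sub>C x + c *\<^sub>C y"
    and scaleC_add_left: "(c + d) *\<^sub>C x = c *\<^sub>C x + d *\<^sub>C x"
    and scaleC_scaleC: "c *\<^sub>C d *\<^sub>C x = (c * d) *\<^sub>C x"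
    and scaleC_one: "1 *\<^sub>C x = x"
    and scaleR_scaleC: "r *\<^sub>R x = complex_of_real r *\<^sub>C x"
    and mult_scaleC_left: "(c *\<^sub>C x) * y = c *\<^sub>C (x * y)"
    and mult_scaleC_right: "x * (c *\<^sub>C y) = c *\<^sub>C (x * y)"
    and norm_scaleC: "norm (c *\<^sub>C x) = cmod c * norm x"

text \<open>Nets are rendered as proper filters: a net in the unit ball is replaced by its
  eventuality filter.\<close>

definition (in real_normed_algebra) contractive_approximate_identity :: "'a filter \<Rightarrow> bool" where
  "contractive_approximate_identity F \<longleftrightarrow>
     F \<noteq> bot \<and> (\<forall>\<^sub>F e in F. norm e \<le> 1) \<and>
     (\<forall>a. ((\<lambda>e. a * e) \<longlongrightarrow> a) F \<and> ((\<lambda>e. e * a) \<longlongrightarrow> a) F)"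

class approx_unital_banach_algebra = complex_banach_algebra +
  assumes approximately_unital: "\<exists>F :: 'a filter. contractive_approximate_identity F"

section \<open>Notions for unital Banach algebras\<close>

definition is_unit :: "'a::real_normed_algebra \<Rightarrow> bool" where
  "is_unit u \<longleftrightarrow> norm u \<le> 1 \<and> (\<forall>a. u * a = a \<and> a * u = a)"

definition unital :: "'a::real_normed_algebra itself \<Rightarrow> bool" where
  "unital _ \<longleftrightarrow> (\<exists>u::'a. is_unit u)"

text \<open>The remaining definitions of this section are meaningful only if the type is unital.
  The library's power and exponential are not available because they need a type class with
  a constant \<open>1\<close> that has norm 1; on such types \<open>alg_exp\<close> is the library's \<open>exp\<close>
  (lemma \<open>alg_exp_eq_exp\<close> below).\<close>

definition alg_unit :: "'a::real_normed_algebra" where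
  "alg_unit = (THE u. is_unit u)"

primrec alg_pow :: "'a::real_normed_algebra \<Rightarrow> nat \<Rightarrow> 'a" where
  "alg_pow a 0 = alg_unit"
| "alg_pow a (Suc n) = a * alg_pow a n"

definition alg_exp :: "'a::{real_normed_algebra, banach} \<Rightarrow> 'a" where
  "alg_exp a = (\<Sum>n. inverse (fact n) *\<^sub>R alg_pow a n)"

definition hermitian_in_unital :: "'a::complex_banach_algebra \<Rightarrow> bool" where
  "hermitian_in_unital a \<longleftrightarrow> (\<forall>t::real. norm (alg_exp ((\<i> * complex_of_real t) *\<^sub>C a)) = 1)"

definition ultrahermitian_in_unital :: "'a::complex_banach_algebra \<Rightarrow> bool" where
  "ultrahermitian_in_unital e \<longleftrightarrow> e * e = e \<and>
     (\<forall>a b. norm a \<le> 1 \<longrightarrow> norm b \<le> 1 \<longrightarrow>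
        norm (e * a * e + (alg_unit - e) * b * (alg_unit - e)) \<le> 1)"

lemma is_unit_unique: "is_unit u \<Longrightarrow> is_unit v \<Longrightarrow> u = v"
  by (metis is_unit_def)

lemma alg_unit_eqI: "is_unit u \<Longrightarrow> alg_unit = u"
  unfolding alg_unit_def using is_unit_unique by blast

lemma alg_pow_eq_power: "alg_pow a n = a ^ n" for a :: "'a::real_normed_algebra_1"
proof -
  have "(alg_unit :: 'a) = 1"
    by (rule alg_unit_eqI) (simp add: is_unit_def)
  then show ?thesis
    by (induction n) auto
qed

lemma alg_exp_eq_exp: "alg_exp a = exp a" for a :: "'a::{real_normed_algebra_1, banach}"
  by (simp add: alg_exp_def exp_def alg_pow_eq_power)

section \<open>The minimal multiplier unitization\<close>

text \<open>The pair \<open>(a, \<mu>)\<close> stands for \<open>a + \<mu>1\<close>. If the algebra is unital, then only the pairs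
  \<open>(a, 0)\<close> occur, so that the unitization is the algebra itself.\<close>

typedef (overloaded) 'a unitization =
    "{x :: 'a::complex_banach_algebra \<times> complex. unital TYPE('a) \<longrightarrow> snd x = 0}"
  by (rule exI[of _ "(0, 0)"]) simp

setup_lifting type_definition_unitization

lift_definition embed :: "'a::complex_banach_algebra \<Rightarrow> 'a unitization" is "\<lambda>a. (a, 0)"
  by simp

lift_definition adj :: "'a::complex_banach_algebra unitization \<Rightarrow> 'a" is fst .

lift_definition scal :: "'a::complex_banach_algebra unitization \<Rightarrow> complex" is snd .

definition act :: "'a::complex_banach_algebra unitization \<Rightarrow> 'a \<Rightarrow> 'a" where
  "act x b = adj x * b + scal x *\<^sub>C b"

lemma unitization_eqI: "adj x = adj y \<Longrightarrow> scal x = scal y \<Longrightarrow> x = y"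
  by transfer (rule prod_eqI)

lemma scal_unital: "unital TYPE('a) \<Longrightarrow> scal (x :: 'a::complex_banach_algebra unitization) = 0"
  by transfer simp

lemma adj_embed [simp]: "adj (embed a) = a" and scal_embed [simp]: "scal (embed a) = 0"
  by (transfer, simp)+

lemma scaleC_zero_left [simp]: "0 *\<^sub>C x = 0" for x :: "'a::complex_banach_algebra"
  using scaleC_add_left[of 0 0 x] by simp

lemma scaleC_zero_right [simp]: "c *\<^sub>C 0 = (0 :: 'a::complex_banach_algebra)"
  using scaleC_add_right[of c 0 "0::'a"] by simp

lemma scaleC_minus_left: "(- c) *\<^sub>C x = - (c *\<^sub>C x)" for x :: "'a::complex_banach_algebra"
  using scaleC_add_left[of "- c" c x] by (simp add: eq_neg_iff_add_eq_0)

lemma scaleC_minus_right: "c *\<^sub>C (- x) = - (c *\<^sub>C x)" for x :: "'a::complex_banach_algebra"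
  using scaleC_add_right[of c "- x" x] by (simp add: eq_neg_iff_add_eq_0)

instantiation unitization :: (complex_banach_algebra) ring
begin

lift_definition zero_unitization :: "'a unitization" is "(0, 0)" by simp

lift_definition plus_unitization :: "'a unitization \<Rightarrow> 'a unitization \<Rightarrow> 'a unitization"
  is "\<lambda>x y. (fst x + fst y, snd x + snd y)" by simp

lift_definition uminus_unitization :: "'a unitization \<Rightarrow> 'a unitization"
  is "\<lambda>x. (- fst x, - snd x)" by simp

lift_definition minus_unitization :: "'a unitization \<Rightarrow> 'a unitization \<Rightarrow> 'a unitization"
  is "\<lambda>x y. (fst x - fst y, snd x - snd y)" by simp

lift_definition times_unitization :: "'a unitization \<Rightarrow> 'a unitization \<Rightarrow> 'a unitization"
  is "\<lambda>x y. (fst x * fst y + snd y *\<^sub>C fst x + snd x *\<^sub>C fst y, snd x * snd y)" by simp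

instance
  by standard
    (transfer; force simp: algebra_simps scaleC_add_right scaleC_add_left scaleC_scaleC
      mult_scaleC_left mult_scaleC_right)+

end

lemma adj_simps [simp]:
  "adj 0 = 0" "adj (x + y) = adj x + adj y" "adj (- x) = - adj x" "adj (x - y) = adj x - adj y"
  "adj (x * y) = adj x * adj y + scal y *\<^sub>C adj x + scal x *\<^sub>C adj y"
  by (transfer; simp)+

lemma scal_simps [simp]:
  "scal 0 = 0" "scal (x + y) = scal x + scal y" "scal (- x) = - scal x"
  "scal (x - y) = scal x - scal y" "scal (x * y) = scal x * scal y"
  by (transfer; simp)+

instantiation unitization :: (complex_banach_algebra) real_vector
begin

lift_definition scaleR_unitization :: "real \<Rightarrow> 'a unitization \<Rightarrow> 'a unitization"
  is "\<lambda>r x. (r *\<^sub>R fst x, complex_of_real r * snd x)" by simp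

instance
  by standard (transfer; simp add: algebra_simps)+

end

lift_definition scaleC_unitization ::
    "complex \<Rightarrow> 'a::complex_banach_algebra unitization \<Rightarrow> 'a unitization"
  is "\<lambda>c x. (c *\<^sub>C fst x, c * snd x)" by simp

lemma adj_scale [simp]: "adj (r *\<^sub>R x) = r *\<^sub>R adj x" "adj (scaleC_unitization c x) = c *\<^sub>C adj x"
  by (transfer; simp)+

lemma scal_scale [simp]:
  "scal (r *\<^sub>R x) = complex_of_real r * scal x" "scal (scaleC_unitization c x) = c * scal x"
  by (transfer; simp)+


lemma act_add: "act (x + y) b = act x b + act y b"
  by (simp add: act_def algebra_simps scaleC_add_left)

lemma act_scaleC: "act (scaleC_unitization c x) b = c *\<^sub>C act x b"
  by (simp add: act_def scaleC_add_right scaleC_scaleC mult_scaleC_left)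

lemma act_mult: "act (x * y) b = act x (act y b)"
  by (simp add: act_def algebra_simps scaleC_add_right scaleC_scaleC mult_scaleC_left
      mult_scaleC_right)

lemma act_scaleC_right: "act x (c *\<^sub>C b) = c *\<^sub>C act x b"
  by (simp add: act_def scaleC_add_right scaleC_scaleC mult_scaleC_right mult.commute)

lemma scaleR_unitization_eq:
  "r *\<^sub>R x = scaleC_unitization (complex_of_real r) x" for x :: "'a::complex_banach_algebra unitization"
  by (rule unitization_eqI) (simp_all add: scaleR_scaleC)

lemma norm_act_le_sum: "norm (act x b) \<le> (norm (adj x) + cmod (scal x)) * norm b"
proof -
  have "norm (act x b) \<le> norm (adj x * b) + norm (scal x *\<^sub>C b)"
    unfolding act_def by (rule norm_triangle_ineq)
  also have "\<dots> \<le> norm (adj x) * norm b + cmod (scal x) * norm b"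
    by (simp add: norm_mult_ineq norm_scaleC)
  finally show ?thesis
    by (simp add: algebra_simps)
qed

lemma approximately_unital_obtain:
  obtains F :: "'a::approx_unital_banach_algebra filter" where
    "F \<noteq> bot" "\<forall>\<^sub>F e in F. norm e \<le> 1"
    "\<forall>a. ((\<lambda>e. a * e) \<longlongrightarrow> a) F" "\<forall>a. ((\<lambda>e. e * a) \<longlongrightarrow> a) F"
  using approximately_unital[where 'a='a] unfolding contractive_approximate_identity_def by blast

lemma left_unit_imp_is_unit:
  fixes u :: "'a::approx_unital_banach_algebra"
  assumes u: "\<And>b. u * b = b"
  shows "is_unit u"
proof -
  obtain F :: "'a filter" where F: "F \<noteq> bot" "\<forall>\<^sub>F e in F. norm e \<le> 1"
    "\<forall>a. ((\<lambda>e. a * e) \<longlongrightarrow> a) F" "\<forall>a. ((\<lambda>e. e * a) \<longlongrightarrow> a) F"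
    using approximately_unital_obtain by blast
  have eq: "(\<lambda>e. u * e) = (\<lambda>e. e)"
    by (rule ext) (rule u)
  have lim: "((\<lambda>e. e) \<longlongrightarrow> u) F"
    using F(3)[rule_format, of u] unfolding eq .
  have "norm u \<le> 1"
    using tendsto_norm[OF lim] F(2) F(1) by (metis tendsto_upperbound)
  moreover have "b * u = b" for b
  proof -
    have "((\<lambda>e. b * e) \<longlongrightarrow> b * u) F"
      by (intro tendsto_intros lim)
    then show ?thesis
      using F(3)[rule_format, of b] F(1) tendsto_unique by blast
  qed
  ultimately show ?thesis
    using u by (simp add: is_unit_def)
qed

lemma norm_le_if_right_mult:
  fixes a :: "'a::approx_unital_banach_algebra"
  assumes "\<And>b. norm b \<le> 1 \<Longrightarrow> norm (a * b) \<le> C"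
  shows "norm a \<le> C"
proof -
  obtain F :: "'a filter" where F: "F \<noteq> bot" "\<forall>\<^sub>F e in F. norm e \<le> 1"
    "\<forall>a. ((\<lambda>e. a * e) \<longlongrightarrow> a) F" "\<forall>a. ((\<lambda>e. e * a) \<longlongrightarrow> a) F"
    using approximately_unital_obtain by blast
  have "\<forall>\<^sub>F e in F. norm (a * e) \<le> C"
    using F(2) by eventually_elim (rule assms)
  then show ?thesis
    using tendsto_norm[OF F(3)[rule_format, of a]] F(1) by (metis tendsto_upperbound)
qed

instantiation unitization :: (approx_unital_banach_algebra) real_normed_algebra
begin

definition norm_unitization :: "'a unitization \<Rightarrow> real" where
  "norm_unitization x =
     (if unital TYPE('a) then norm (adj x)
      else (SUP b\<in>{b. norm b \<le> 1}. norm (adj x * b + scal x *\<^sub>C b)))"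

definition dist_unitization :: "'a unitization \<Rightarrow> 'a unitization \<Rightarrow> real" where
  "dist_unitization x y = norm (x - y)"

definition uniformity_unitization :: "('a unitization \<times> 'a unitization) filter" where
  "uniformity_unitization = (INF e\<in>{0 <..}. principal {(x, y). dist x y < e})"

definition open_unitization :: "'a unitization set \<Rightarrow> bool" where
  "open_unitization U \<longleftrightarrow> (\<forall>x\<in>U. \<forall>\<^sub>F (x', y) in uniformity. x' = x \<longrightarrow> y \<in> U)"

definition sgn_unitization :: "'a unitization \<Rightarrow> 'a unitization" where
  "sgn_unitization x = x /\<^sub>R norm x"

lemma norm_unital: "unital TYPE('a) \<Longrightarrow> norm (x :: 'a unitization) = norm (adj x)"
  by (simp add: norm_unitization_def)

lemma norm_nonunital:
  "\<not> unital TYPE('a) \<Longrightarrow> norm (x :: 'a unitization) = (SUP b\<in>{b. norm b \<le> 1}. norm (act x b))"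
  by (simp add: norm_unitization_def act_def)

lemma bdd_act: "bdd_above ((\<lambda>b. norm (act x b)) ` {b. norm b \<le> 1})"
  for x :: "'a unitization"
proof (rule bdd_aboveI2)
  fix b :: 'a
  assume "b \<in> {b. norm b \<le> 1}"
  then have "(norm (adj x) + cmod (scal x)) * norm b \<le> (norm (adj x) + cmod (scal x)) * 1"
    by (intro mult_left_mono) auto
  then show "norm (act x b) \<le> norm (adj x) + cmod (scal x)"
    using norm_act_le_sum[of x b] by (metis mult.right_neutral order_trans)
qed

lemma norm_act_unit_ball: "norm b \<le> 1 \<Longrightarrow> norm (act x b) \<le> norm x" for x :: "'a unitization"
proof (cases "unital TYPE('a)")
  case True
  assume "norm b \<le> 1"
  have "norm (act x b) \<le> norm (adj x) * norm b"
    by (simp add: act_def scal_unital[OF True] norm_mult_ineq)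
  also have "\<dots> \<le> norm (adj x) * 1"
    using \<open>norm b \<le> 1\<close> by (intro mult_left_mono) auto
  finally show ?thesis
    by (simp add: norm_unital[OF True])
next
  case False
  assume "norm b \<le> 1"
  then show ?thesis
    unfolding norm_nonunital[OF False] using bdd_act by (intro cSUP_upper) auto
qed

lemma norm_act: "norm (act x b) \<le> norm x * norm b" for x :: "'a unitization"
proof (cases "b = 0")
  case True
  then show ?thesis by (simp add: act_def)
next
  case False
  let ?r = "complex_of_real (inverse (norm b))"
  have "norm (?r *\<^sub>C b) \<le> 1"
    using False by (simp add: norm_scaleC norm_inverse)
  then have "norm (act x (?r *\<^sub>C b)) \<le> norm x"
    by (rule norm_act_unit_ball)
  then show ?thesis
    using False by (simp add: act_scaleC_right norm_scaleC norm_of_real norm_divide divide_simps mult.commute)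
qed

lemma norm_leI:
  fixes x :: "'a unitization"
  assumes "\<And>b. norm b \<le> 1 \<Longrightarrow> norm (act x b) \<le> C"
  shows "norm x \<le> C"
proof (cases "unital TYPE('a)")
  case True
  then show ?thesis
    using assms by (simp add: norm_unital[OF True] act_def scal_unital[OF True] norm_le_if_right_mult)
next
  case False
  show ?thesis
    unfolding norm_nonunital[OF False] by (rule cSUP_least) (auto intro: assms exI[of _ 0])
qed

lemma norm_nonneg: "0 \<le> norm x" for x :: "'a unitization"
  using norm_act_unit_ball[of 0 x] by (simp add: act_def)

lemma norm_embed: "norm (embed a) = norm a" for a :: 'a
proof (rule antisym)
  show "norm (embed a) \<le> norm a"
  proof (rule norm_leI)
    fix b :: 'a
    assume "norm b \<le> 1"
    have "norm (a * b) \<le> norm a * norm b"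
      by (rule norm_mult_ineq)
    also have "\<dots> \<le> norm a * 1"
      using \<open>norm b \<le> 1\<close> by (intro mult_left_mono) auto
    finally show "norm (act (embed a) b) \<le> norm a"
      by (simp add: act_def)
  qed
  show "norm a \<le> norm (embed a)"
  proof (rule norm_le_if_right_mult)
    fix b :: 'a
    assume "norm b \<le> 1"
    then show "norm (a * b) \<le> norm (embed a)"
      using norm_act_unit_ball[of b "embed a"] by (simp add: act_def)
  qed
qed

lemma norm_scaleC_unitization: "norm (scaleC_unitization c x) = cmod c * norm x"
  for x :: "'a unitization"
proof -
  have le: "norm (scaleC_unitization c x) \<le> cmod c * norm x" for c and x :: "'a unitization"
    by (rule norm_leI) (simp add: act_scaleC norm_scaleC mult_left_mono norm_act_unit_ball)
  show ?thesis
  proof (cases "c = 0")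
    case True
    then show ?thesis
      using le[of c x] norm_nonneg[of "scaleC_unitization c x"] by simp
  next
    case False
    have "x = scaleC_unitization (inverse c) (scaleC_unitization c x)"
      using False by (intro unitization_eqI) (simp_all add: scaleC_scaleC scaleC_one)
    then have "norm x \<le> cmod (inverse c) * norm (scaleC_unitization c x)"
      using le by metis
    then have "cmod c * norm x \<le> norm (scaleC_unitization c x)"
      using False by (simp add: norm_divide divide_simps mult.commute)
    with le[of c x] show ?thesis by simp
  qed
qed

lemma norm_eq_0: "norm x = 0 \<longleftrightarrow> x = 0" for x :: "'a unitization"
proof
  assume "norm x = 0"
  then have act0: "act x b = 0" for b
    using norm_act[of x b] by simp
  show "x = 0"
  proof (cases "scal x = 0")
    case True
    then have "adj x * b = 0" for b
      using act0[of b] by (simp add: act_def)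
    then have "adj x = 0"
      using norm_le_if_right_mult[of "adj x" 0] by simp
    with True show ?thesis
      by (simp add: unitization_eqI)
  next
    case False
    let ?u = "(- inverse (scal x)) *\<^sub>C adj x"
    have "?u * b = b" for b
    proof -
      have "(- inverse (scal x)) *\<^sub>C act x b = 0"
        by (simp add: act0)
      then have "?u * b + (- inverse (scal x) * scal x) *\<^sub>C b = 0"
        by (simp only: act_def scaleC_add_right mult_scaleC_left scaleC_scaleC)
      then show ?thesis
        using False by (simp add: scaleC_minus_left scaleC_one)
    qed
    then have "unital TYPE('a)"
      unfolding unital_def using left_unit_imp_is_unit by blast
    with False show ?thesis
      by (simp add: scal_unital)
  qed
next
  assume "x = 0"
  then show "norm x = 0"
    using norm_embed[of "0::'a"] by (metis adj_embed adj_simps(1) norm_zero scal_embed scal_simps(1) unitization_eqI)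
qed

lemma norm_add_le: "norm (x + y) \<le> norm x + norm y" for x y :: "'a unitization"
proof (rule norm_leI)
  fix b :: 'a
  assume b: "norm b \<le> 1"
  have "norm (act (x + y) b) \<le> norm (act x b) + norm (act y b)"
    unfolding act_add by (rule norm_triangle_ineq)
  then show "norm (act (x + y) b) \<le> norm x + norm y"
    using norm_act_unit_ball[OF b, of x] norm_act_unit_ball[OF b, of y] by linarith
qed

lemma norm_mult_le: "norm (x * y) \<le> norm x * norm y" for x y :: "'a unitization"
proof (rule norm_leI)
  fix b :: 'a
  assume b: "norm b \<le> 1"
  have "norm (act (x * y) b) \<le> norm x * norm (act y b)"
    unfolding act_mult by (rule norm_act)
  also have "\<dots> \<le> norm x * norm y"
    by (intro mult_left_mono norm_act_unit_ball b norm_nonneg)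
  finally show "norm (act (x * y) b) \<le> norm x * norm y" .
qed

lemma norm_unitization_le: "norm x \<le> norm (adj x) + cmod (scal x)" for x :: "'a unitization"
proof (rule norm_leI)
  fix b :: 'a
  assume "norm b \<le> 1"
  then have "(norm (adj x) + cmod (scal x)) * norm b \<le> (norm (adj x) + cmod (scal x)) * 1"
    by (intro mult_left_mono) auto
  then show "norm (act x b) \<le> norm (adj x) + cmod (scal x)"
    using norm_act_le_sum[of x b] by (metis mult.right_neutral order_trans)
qed

text \<open>The algebra is complete and hence closed in its unitization, so the projection to the
  scalar part is bounded.\<close>

lemma scal_bounded: "\<exists>C>0. \<forall>x::'a unitization. cmod (scal x) \<le> C * norm x"
proof (rule ccontr)
  assume neg: "\<not> ?thesis"
  have "\<exists>x::'a unitization. scal x = 1 \<and> norm x < 1 / real (Suc n)" for n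
  proof -
    obtain x :: "'a unitization" where x: "cmod (scal x) > real (Suc n) * norm x"
      using neg by (metis of_nat_0_less_iff not_le zero_less_Suc)
    have nz: "scal x \<noteq> 0"
    proof
      assume "scal x = 0"
      with x have "real (Suc n) * norm x < 0" by simp
      moreover have "0 \<le> real (Suc n) * norm x"
        by (intro mult_nonneg_nonneg norm_nonneg) simp
      ultimately show False by simp
    qed
    let ?y = "scaleC_unitization (inverse (scal x)) x"
    have "norm ?y = norm x / cmod (scal x)"
      using nz by (simp add: norm_scaleC_unitization norm_divide divide_simps)
    moreover have "norm x / cmod (scal x) < 1 / real (Suc n)"
      using x nz by (simp add: divide_simps mult.commute)
    moreover have "scal ?y = 1"
      using nz by simp
    ultimately show ?thesis by metis
  qed
  then obtain y :: "nat \<Rightarrow> 'a unitization"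
    where y: "\<And>n. scal (y n) = 1" "\<And>n. norm (y n) < 1 / real (Suc n)"
    by metis
  have diff: "norm (adj (y m) - adj (y n)) \<le> norm (y m) + norm (y n)" for m n
  proof -
    have "embed (adj (y m) - adj (y n)) = y m + scaleC_unitization (- 1) (y n)"
      by (rule unitization_eqI) (simp_all add: y scaleC_minus_left scaleC_one)
    then have "norm (adj (y m) - adj (y n)) = norm (y m + scaleC_unitization (- 1) (y n))"
      by (metis norm_embed)
    also have "\<dots> \<le> norm (y m) + norm (scaleC_unitization (- 1) (y n))"
      by (rule norm_add_le)
    finally show ?thesis
      by (simp add: norm_scaleC_unitization)
  qed
  have lim0: "(\<lambda>n. norm (y n)) \<longlonglongrightarrow> 0"
  proof (rule tendsto_sandwich[OF _ _ tendsto_const])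
    show "(\<lambda>n. 1 / real (Suc n)) \<longlonglongrightarrow> 0"
      using LIMSEQ_inverse_real_of_nat by (simp add: inverse_eq_divide)
    show "\<forall>\<^sub>F n in sequentially. norm (y n) \<le> 1 / real (Suc n)"
      by (intro always_eventually allI less_imp_le y(2))
  qed (intro always_eventually allI norm_nonneg)
  have "Cauchy (\<lambda>n. adj (y n))"
  proof (rule CauchyI)
    fix e :: real
    assume "0 < e"
    then have "\<forall>\<^sub>F n in sequentially. norm (y n) < e / 2"
      using order_tendstoD(2)[OF lim0, of "e / 2"] by simp
    then obtain N where N: "\<And>n. n \<ge> N \<Longrightarrow> norm (y n) < e / 2"
      unfolding eventually_sequentially by blast
    have "norm (adj (y m) - adj (y n)) < e" if "m \<ge> N" "n \<ge> N" for m n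
      using diff[of m n] N[OF that(1)] N[OF that(2)] by linarith
    then show "\<exists>M. \<forall>m\<ge>M. \<forall>n\<ge>M. norm (adj (y m) - adj (y n)) < e" by blast
  qed
  then obtain a where a: "(\<lambda>n. adj (y n)) \<longlonglongrightarrow> a"
    using Cauchy_convergent convergent_def by blast
  define z where "z = y 0 + embed (a - adj (y 0))"
  have z: "adj z = a" "scal z = 1"
    by (simp_all add: z_def y)
  have "norm z \<le> norm (y n) + norm (a - adj (y n))" for n
  proof -
    have "z = y n + embed (a - adj (y n))"
      by (rule unitization_eqI) (simp_all add: z y)
    then show ?thesis
      by (metis norm_add_le norm_embed)
  qed
  moreover have "(\<lambda>n. norm (y n) + norm (a - adj (y n))) \<longlonglongrightarrow> 0 + norm (a - a)"
    by (intro tendsto_intros lim0 a)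
  ultimately have "norm z \<le> 0 + norm (a - a)"
    by (intro LIMSEQ_le_const[of _ _ "norm z"]) auto
  then have "norm z \<le> 0"
    by simp
  then have "z = 0"
    using norm_nonneg[of z] norm_eq_0[of z] by simp
  with z show False by simp
qed

instance
proof
  fix x y :: "'a unitization" and r :: real
  show "dist x y = norm (x - y)" by (rule dist_unitization_def)
  show "sgn x = x /\<^sub>R norm x" by (rule sgn_unitization_def)
  show "uniformity = (INF e\<in>{0 <..}. principal {(x :: 'a unitization, y). dist x y < e})"
    by (rule uniformity_unitization_def)
  show "open U = (\<forall>x\<in>U. \<forall>\<^sub>F (x', y) in uniformity. x' = x \<longrightarrow> y \<in> U)" for U :: "'a unitization set"
    by (rule open_unitization_def)
  show "norm x = 0 \<longleftrightarrow> x = 0" by (rule norm_eq_0)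
  show "norm (x + y) \<le> norm x + norm y" by (rule norm_add_le)
  show "norm (x * y) \<le> norm x * norm y" by (rule norm_mult_le)
  show "norm (r *\<^sub>R x) = \<bar>r\<bar> * norm x"
    by (simp add: scaleR_unitization_eq norm_scaleC_unitization)
  show "r *\<^sub>R x * y = r *\<^sub>R (x * y)" "x * r *\<^sub>R y = r *\<^sub>R (x * y)"
    by (rule unitization_eqI; simp add: algebra_simps scaleR_scaleC scaleC_scaleC mult_scaleC_left
        mult_scaleC_right scaleC_add_right)+
qed

end

instance unitization :: (approx_unital_banach_algebra) banach
proof
  fix X :: "nat \<Rightarrow> 'a unitization"
  assume X: "Cauchy X"
  have X': "\<exists>M. \<forall>m\<ge>M. \<forall>n\<ge>M. norm (X m - X n) < e" if "e > 0" for e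
    using X that unfolding Cauchy_def dist_norm by blast
  obtain C where C: "C > 0" "\<And>x::'a unitization. cmod (scal x) \<le> C * norm x"
    using scal_bounded by blast
  have adj_le: "norm (adj x) \<le> (1 + C) * norm x" for x :: "'a unitization"
  proof (cases "unital TYPE('a)")
    case True
    then show ?thesis
      using C(1) mult_nonneg_nonneg[of C "norm (adj x)"] by (simp add: norm_unital[OF True] algebra_simps)
  next
    case False
    define u :: "'a unitization" where "u = Abs_unitization (0, 1)"
    have u: "adj u = 0" "scal u = 1"
      using False by (simp_all add: u_def adj.rep_eq scal.rep_eq Abs_unitization_inverse)
    have "embed (adj x) = x + scaleC_unitization (- scal x) u"
      by (rule unitization_eqI) (simp_all add: u)
    then have "norm (adj x) \<le> norm x + cmod (scal x) * norm u"
      by (metis norm_add_le norm_embed norm_scaleC_unitization norm_minus_cancel)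
    moreover have "norm u \<le> 1"
      using norm_unitization_le[of u] by (simp add: u)
    then have "cmod (scal x) * norm u \<le> cmod (scal x) * 1"
      by (intro mult_left_mono) auto
    ultimately show ?thesis
      using C(2)[of x] by (simp add: algebra_simps)
  qed
  have "Cauchy (\<lambda>n. adj (X n))"
  proof (rule CauchyI)
    fix e :: real
    assume "0 < e"
    then obtain M where M: "\<forall>m\<ge>M. \<forall>n\<ge>M. norm (X m - X n) < e / (1 + C)"
      using X'[of "e / (1 + C)"] C(1) by auto
    have "norm (adj (X m) - adj (X n)) < e" if "m \<ge> M" "n \<ge> M" for m n
    proof -
      have "(1 + C) * norm (X m - X n) < (1 + C) * (e / (1 + C))"
        using M that C(1) by (intro mult_strict_left_mono) auto
      then show ?thesis
        using adj_le[of "X m - X n"] C(1) by simp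
    qed
    then show "\<exists>M. \<forall>m\<ge>M. \<forall>n\<ge>M. norm (adj (X m) - adj (X n)) < e" by blast
  qed
  then obtain a where a: "(\<lambda>n. adj (X n)) \<longlonglongrightarrow> a"
    using Cauchy_convergent convergent_def by blast
  have "Cauchy (\<lambda>n. scal (X n))"
  proof (rule CauchyI)
    fix e :: real
    assume "0 < e"
    then obtain M where M: "\<forall>m\<ge>M. \<forall>n\<ge>M. norm (X m - X n) < e / C"
      using X'[of "e / C"] C(1) by auto
    have "norm (scal (X m) - scal (X n)) < e" if "m \<ge> M" "n \<ge> M" for m n
    proof -
      have "C * norm (X m - X n) < C * (e / C)"
        using M that C(1) by (intro mult_strict_left_mono) auto
      then show ?thesis
        using C(2)[of "X m - X n"] C(1) by simp
    qed
    then show "\<exists>M. \<forall>m\<ge>M. \<forall>n\<ge>M. norm (scal (X m) - scal (X n)) < e" by blast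
  qed
  then obtain \<mu> where mu: "(\<lambda>n. scal (X n)) \<longlonglongrightarrow> \<mu>"
    using Cauchy_convergent convergent_def by blast
  define x :: "'a unitization" where "x = Abs_unitization (a, \<mu>)"
  have "unital TYPE('a) \<longrightarrow> \<mu> = 0"
    using mu by (auto simp: scal_unital LIMSEQ_const_iff)
  then have x: "adj x = a" "scal x = \<mu>"
    by (simp_all add: x_def adj.rep_eq scal.rep_eq Abs_unitization_inverse)
  have lim: "(\<lambda>n. norm (adj (X n) - a) + cmod (scal (X n) - \<mu>)) \<longlonglongrightarrow> norm (a - a) + cmod (\<mu> - \<mu>)"
    by (intro tendsto_intros a mu)
  have "(\<lambda>n. norm (X n - x)) \<longlonglongrightarrow> 0"
  proof (rule tendsto_sandwich[OF _ _ tendsto_const])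
    show "(\<lambda>n. norm (adj (X n) - a) + cmod (scal (X n) - \<mu>)) \<longlonglongrightarrow> 0"
      using lim by simp
    have "norm (X n - x) \<le> norm (adj (X n) - a) + cmod (scal (X n) - \<mu>)" for n
      using norm_unitization_le[of "X n - x"] by (simp add: x)
    then show "\<forall>\<^sub>F n in sequentially. norm (X n - x) \<le> norm (adj (X n) - a) + cmod (scal (X n) - \<mu>)"
      by simp
  qed simp
  then have "X \<longlonglongrightarrow> x"
    using LIM_zero_iff tendsto_norm_zero_iff by blast
  then show "convergent X"
    by (rule convergentI)
qed

instantiation unitization :: (approx_unital_banach_algebra) complex_banach_algebra
begin

definition scaleC_unitization_inst: "scaleC = scaleC_unitization"

instance
proof
  fix x y :: "'a unitization" and c d :: complex and r :: real
  show "c *\<^sub>C (x + y) = c *\<^sub>C x + c *\<^sub>C y" "(c + d) *\<^sub>C x = c *\<^sub>C x + d *\<^sub>C x"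
    "c *\<^sub>C d *\<^sub>C x = (c * d) *\<^sub>C x" "1 *\<^sub>C x = x" "r *\<^sub>R x = complex_of_real r *\<^sub>C x"
    "(c *\<^sub>C x) * y = c *\<^sub>C (x * y)" "x * (c *\<^sub>C y) = c *\<^sub>C (x * y)"
    unfolding scaleC_unitization_inst
    by (rule unitization_eqI; simp add: algebra_simps scaleR_scaleC scaleC_scaleC mult_scaleC_left
        mult_scaleC_right scaleC_add_right scaleC_add_left scaleC_one)+
  show "norm (c *\<^sub>C x) = cmod c * norm x"
    unfolding scaleC_unitization_inst by (rule norm_scaleC_unitization)
qed

end

lemma unital_unitization: "unital TYPE('a::approx_unital_banach_algebra unitization)"
proof (cases "unital TYPE('a)")
  case True
  then obtain u :: 'a where u: "is_unit u"
    by (auto simp: unital_def)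
  have "is_unit (embed u)"
    using u by (auto simp: is_unit_def norm_embed scal_unital[OF True] intro!: unitization_eqI)
  then show ?thesis
    by (auto simp: unital_def)
next
  case False
  define u :: "'a unitization" where "u = Abs_unitization (0, 1)"
  have u: "adj u = 0" "scal u = 1"
    using False by (simp_all add: u_def adj.rep_eq scal.rep_eq Abs_unitization_inverse)
  have "is_unit u"
    using norm_unitization_le[of u] u
    by (auto simp: is_unit_def scaleC_one intro!: unitization_eqI)
  then show ?thesis
    by (auto simp: unital_def)
qed

section \<open>Notions for approximately unital Banach algebras\<close>

definition hermitian :: "'a::approx_unital_banach_algebra \<Rightarrow> bool" where
  "hermitian a \<longleftrightarrow> hermitian_in_unital (embed a)"

definition ultrahermitian :: "'a::approx_unital_banach_algebra \<Rightarrow> bool" where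
  "ultrahermitian e \<longleftrightarrow> ultrahermitian_in_unital (embed e)"

definition is_MP_inverse :: "'a::approx_unital_banach_algebra \<Rightarrow> 'a \<Rightarrow> bool" where
  "is_MP_inverse a b \<longleftrightarrow>
     a = a * b * a \<and> b = b * a * b \<and> hermitian (a * b) \<and> hermitian (b * a)"

definition MP_invertible :: "'a::approx_unital_banach_algebra set" where
  "MP_invertible = {a. \<exists>b. is_MP_inverse a b}"

definition MP_inverse :: "'a::approx_unital_banach_algebra \<Rightarrow> 'a"  (\<open>_\<^sup>\<dagger>\<close> [1000] 999) where
  "a\<^sup>\<dagger> = (THE b. is_MP_inverse a b)"

end

theory Submission
  imports Defs
begin

text \<open>
  Write \<open>x, x\<^sub>n\<close> for the Moore-Penrose inverses of \<open>a, a\<^sub>n\<close> and \<open>d = a\<^sub>n - a\<close>. Two identities, written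
  in the unitization, carry the proof. Since \<open>a (1 - x a) = 0\<close> and \<open>a\<^sub>n (1 - x\<^sub>n a\<^sub>n) = 0\<close>,
  commutativity of the idempotents \<open>x a\<close> and \<open>x\<^sub>n a\<^sub>n\<close> gives
  \<open>x\<^sub>n a\<^sub>n - x a = x\<^sub>n d (1 - x a) + x d (1 - x\<^sub>n a\<^sub>n)\<close>, and symmetrically for \<open>a\<^sub>n x\<^sub>n - a x\<close>;
  so the idempotents converge as soon as \<open>x\<^sub>n\<close> is bounded. Conversely,
  \<open>x\<^sub>n - x = x\<^sub>n (a\<^sub>n x\<^sub>n - a x - d x) + (x\<^sub>n a\<^sub>n - x a) x\<close> shows that convergence of the idempotents
  first bounds \<open>x\<^sub>n\<close> and then forces \<open>x\<^sub>n \<rightarrow> x\<close>.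
\<close>

text \<open>The algebraic half of the Moore-Penrose conditions, split off from hermiticity so that
  the identities below can be proved in rings.\<close>

definition reflexive_inverse :: "'a::semigroup_mult \<Rightarrow> 'a \<Rightarrow> bool" where
  "reflexive_inverse a x \<longleftrightarrow> a * x * a = a \<and> x * a * x = x"

text \<open>Rewrite rules for right-nested products; the versions with a trailing \<open>y\<close>
  fire inside longer words.\<close>

lemma reflexive_inverse_simps:
  assumes "reflexive_inverse a x"
  shows "a * (x * a) = a" "x * (a * x) = x" "a * (x * (a * y)) = a * y" "x * (a * (x * y)) = x * y"
  using assms unfolding reflexive_inverse_def by (metis mult.assoc)+

text \<open>Since \<open>(a * x) * (a * y) = a * y\<close> and
  \<open>(a * y) * (a * x) = a * x\<close>, commuting forces \<open>a * x = a * y\<close>; likewise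
  \<open>x * a = y * a\<close>.\<close>

lemma reflexive_inverse_unique:
  assumes x: "reflexive_inverse a x" and y: "reflexive_inverse a y"
    and comm: "(a * x) * (a * y) = (a * y) * (a * x)" "(x * a) * (y * a) = (y * a) * (x * a)"
  shows "x = y"
proof -
  note simps = mult.assoc reflexive_inverse_simps[OF x] reflexive_inverse_simps[OF y]
  have 1: "a * x = a * y"
    using comm(1) by (simp add: simps)
  have 2: "x * a = y * a"
    using comm(2) by (simp add: simps)
  have "x = x * (a * x)"
    by (simp add: simps)
  also have "\<dots> = (x * a) * y"
    by (simp add: 1 mult.assoc)
  also have "\<dots> = y"
    by (simp add: 2 simps)
  finally show ?thesis .
qed

text \<open>The two summands reduce to \<open>y * b - y * b * x * a\<close> and
  \<open>x * a * y * b - x * a\<close>; commutativity cancels the mixed products. The factors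
  \<open>1 - x * a\<close> and \<open>1 - y * b\<close> are multiplied out since the ring may lack a
  unit.\<close>

lemma left_idempotent_diff:
  fixes a b x y :: "'a::ring"
  assumes x: "reflexive_inverse a x" and y: "reflexive_inverse b y"
    and comm: "(x * a) * (y * b) = (y * b) * (x * a)"
  shows "y * b - x * a = y * ((b - a) - (b - a) * (x * a)) + x * ((b - a) - (b - a) * (y * b))"
  using comm
  by (simp add: algebra_simps reflexive_inverse_simps[OF x] reflexive_inverse_simps[OF y])

lemma right_idempotent_diff:
  fixes a b x y :: "'a::ring"
  assumes x: "reflexive_inverse a x" and y: "reflexive_inverse b y"
    and comm: "(a * x) * (b * y) = (b * y) * (a * x)"
  shows "b * y - a * x = ((b - a) - (a * x) * (b - a)) * y + ((b - a) - (b * y) * (b - a)) * x"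
  using comm
  by (simp add: algebra_simps reflexive_inverse_simps[OF x] reflexive_inverse_simps[OF y])

text \<open>The right-hand side telescopes: its summands are \<open>y - y * b * x\<close> and
  \<open>y * b * x - x\<close>.\<close>

lemma reflexive_inverse_diff:
  fixes a b x y :: "'a::ring"
  assumes x: "reflexive_inverse a x" and y: "reflexive_inverse b y"
  shows "y - x = y * (b * y - a * x - (b - a) * x) + (y * b - x * a) * x"
  by (simp add: algebra_simps reflexive_inverse_simps[OF x] reflexive_inverse_simps[OF y])

lemma tendsto_mult_Bfun_zero:
  fixes f g :: "'b \<Rightarrow> 'a::real_normed_algebra"
  assumes "Bfun f F" "(g \<longlongrightarrow> 0) F"
  shows "((\<lambda>n. f n * g n) \<longlongrightarrow> 0) F" "((\<lambda>n. g n * f n) \<longlongrightarrow> 0) F"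
  using bounded_bilinear.Bfun_prod_Zfun[OF bounded_bilinear_mult, of f F g]
    bounded_bilinear.Zfun_prod_Bfun[OF bounded_bilinear_mult, of g F f] assms
  by (simp_all add: tendsto_Zfun_iff)

context
  fixes a x :: "nat \<Rightarrow> 'a::real_normed_algebra" and a' x' :: 'a
  assumes inv: "\<And>n. reflexive_inverse (a n) (x n)" and inv': "reflexive_inverse a' x'"
    and lim: "a \<longlonglongrightarrow> a'"
begin

lemma left_idempotents_tendsto:
  assumes bdd: "Bseq x" and comm: "\<And>n. (x' * a') * (x n * a n) = (x n * a n) * (x' * a')"
  shows "(\<lambda>n. x n * a n) \<longlonglongrightarrow> x' * a'"
proof -
  have d: "(\<lambda>n. a n - a') \<longlonglongrightarrow> 0"
    using lim by (simp add: LIM_zero)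
  have "(\<lambda>n. x n * ((a n - a') - (a n - a') * (x' * a'))) \<longlonglongrightarrow> 0"
    using tendsto_diff[OF d tendsto_mult_left_zero[OF d]] by (simp add: tendsto_mult_Bfun_zero(1)[OF bdd])
  \<comment> \<open>Regrouped so that the bounded \<open>x n\<close> sits next to the null factor
    \<open>a n - a'\<close>, with only the convergent \<open>a n\<close> outside.\<close>
  moreover have "(\<lambda>n. x' * ((a n - a') - ((a n - a') * x n) * a n)) \<longlonglongrightarrow> x' * (0 - 0 * a')"
    by (intro tendsto_intros d lim tendsto_mult_Bfun_zero(2)[OF bdd])
  ultimately have "(\<lambda>n. x n * a n - x' * a') \<longlonglongrightarrow> 0 + x' * (0 - 0 * a')"
    unfolding left_idempotent_diff[OF inv' inv comm] mult.assoc by (rule tendsto_add)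
  then show ?thesis
    by (simp add: LIM_zero_iff)
qed

lemma right_idempotents_tendsto:
  assumes bdd: "Bseq x" and comm: "\<And>n. (a' * x') * (a n * x n) = (a n * x n) * (a' * x')"
  shows "(\<lambda>n. a n * x n) \<longlonglongrightarrow> a' * x'"
proof -
  have d: "(\<lambda>n. a n - a') \<longlonglongrightarrow> 0"
    using lim by (simp add: LIM_zero)
  have "(\<lambda>n. ((a n - a') - (a' * x') * (a n - a')) * x n) \<longlonglongrightarrow> 0"
    using tendsto_diff[OF d tendsto_mult_right_zero[OF d]] by (simp add: tendsto_mult_Bfun_zero(2)[OF bdd])
  moreover have "(\<lambda>n. ((a n - a') - a n * (x n * (a n - a'))) * x') \<longlonglongrightarrow> (0 - a' * 0) * x'"
    by (intro tendsto_intros d lim tendsto_mult_Bfun_zero(1)[OF bdd])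
  ultimately have "(\<lambda>n. a n * x n - a' * x') \<longlonglongrightarrow> 0 + (0 - a' * 0) * x'"
    unfolding right_idempotent_diff[OF inv' inv comm] mult.assoc by (rule tendsto_add)
  then show ?thesis
    by (simp add: LIM_zero_iff)
qed

lemma reflexive_inverses_tendsto:
  assumes left: "(\<lambda>n. x n * a n) \<longlonglongrightarrow> x' * a'" and right: "(\<lambda>n. a n * x n) \<longlonglongrightarrow> a' * x'"
  shows "x \<longlonglongrightarrow> x'"
proof -
  define r where "r n = a n * x n - a' * x' - (a n - a') * x'" for n
  define s where "s n = (x n * a n - x' * a') * x'" for n
  have diff: "x n - x' = x n * r n + s n" for n
    unfolding r_def s_def by (rule reflexive_inverse_diff[OF inv' inv])
  have "r \<longlonglongrightarrow> (a' * x' - a' * x') - (a' - a') * x'"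
    unfolding r_def by (intro tendsto_intros right lim)
  then have r: "r \<longlonglongrightarrow> 0"
    by simp
  have "s \<longlonglongrightarrow> (x' * a' - x' * a') * x'"
    unfolding s_def by (intro tendsto_intros left)
  then have s: "s \<longlonglongrightarrow> 0"
    by simp
  \<comment> \<open>Below \<open>1 / 2\<close>, the term \<open>x n * r n\<close> costs at most half
    of \<open>norm (x n)\<close>, which the left side absorbs; this bounds \<open>x\<close> before
    its convergence is known.\<close>
  have "\<forall>\<^sub>F n in sequentially. norm (r n) < 1 / 2"
    using order_tendstoD(2)[OF tendsto_norm[OF r], of "1 / 2"] by simp
  moreover have "\<forall>\<^sub>F n in sequentially. norm (s n) < 1"
    using order_tendstoD(2)[OF tendsto_norm[OF s], of 1] by simp
  ultimately have "\<forall>\<^sub>F n in sequentially. norm (x n) \<le> 2 * (norm x' + 1)"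
  proof eventually_elim
    case (elim n)
    have "x n = x n * r n + s n + x'"
      using diff[of n] by (simp add: algebra_simps)
    then have "norm (x n) \<le> norm (x n * r n) + norm (s n) + norm x'"
      by (metis norm_triangle_ineq norm_triangle_mono order_refl)
    also have "norm (x n * r n) \<le> norm (x n) * (1 / 2)"
      using elim(1) by (intro order_trans[OF norm_mult_ineq] mult_left_mono) auto
    finally show ?case
      using elim(2) by simp
  qed
  then have "Bseq x"
    by (rule BfunI)
  then have "(\<lambda>n. x n * r n + s n) \<longlonglongrightarrow> 0 + 0"
    by (intro tendsto_add tendsto_mult_Bfun_zero(1) r s)
  then show ?thesis
    by (simp add: diff[symmetric] LIM_zero_iff)
qed

end

lemma is_MP_inverse_imp_reflexive_inverse: "is_MP_inverse a x \<Longrightarrow> reflexive_inverse a x"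
  by (simp add: is_MP_inverse_def reflexive_inverse_def)

lemma is_MP_inverse_idempotents:
  assumes "is_MP_inverse a x"
  shows "(a * x) * (a * x) = a * x" "hermitian (a * x)" "(x * a) * (x * a) = x * a" "hermitian (x * a)"
  using assms by (simp_all add: is_MP_inverse_def mult.assoc[symmetric])

text \<open>Commuting hermitian idempotents give the uniqueness that the definite description in
  \<open>MP_inverse\<close> requires.\<close>

lemma is_MP_inverse_MP_inverse:
  fixes a :: "'a::approx_unital_banach_algebra"
  assumes "\<And>e f::'a. e * e = e \<Longrightarrow> hermitian e \<Longrightarrow> f * f = f \<Longrightarrow> hermitian f \<Longrightarrow> e * f = f * e"
    and "a \<in> MP_invertible"
  shows "is_MP_inverse a (a\<^sup>\<dagger>)"
proof -
  obtain x where x: "is_MP_inverse a x"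
    using assms(2) by (auto simp: MP_invertible_def)
  have "y = x" if y: "is_MP_inverse a y" for y
  proof (rule reflexive_inverse_unique)
    note idem = is_MP_inverse_idempotents[OF x] is_MP_inverse_idempotents[OF y]
    show "reflexive_inverse a y" "reflexive_inverse a x"
      by (fact is_MP_inverse_imp_reflexive_inverse[OF y] is_MP_inverse_imp_reflexive_inverse[OF x])+
    show "(a * y) * (a * x) = (a * x) * (a * y)"
      by (rule assms(1)) (fact idem)+
    show "(y * a) * (x * a) = (x * a) * (y * a)"
      by (rule assms(1)) (fact idem)+
  qed
  with x show ?thesis
    unfolding MP_inverse_def by (rule theI)
qed

theorem theorem2p23:
  fixes a :: "nat \<Rightarrow> 'a::approx_unital_banach_algebra" and a' :: 'a
  assumes "\<And>e::'a. e * e = e \<Longrightarrow> hermitian e \<Longrightarrow> ultrahermitian e"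
    and "\<And>e f::'a. e * e = e \<Longrightarrow> hermitian e \<Longrightarrow> f * f = f \<Longrightarrow> hermitian f \<Longrightarrow> e * f = f * e"
    and "\<And>n. a n \<in> MP_invertible"
    and "a' \<in> MP_invertible"
    and "a \<longlonglongrightarrow> a'"
  shows "((\<lambda>n. (a n)\<^sup>\<dagger>) \<longlonglongrightarrow> a'\<^sup>\<dagger> \<longleftrightarrow> bdd_above (range (\<lambda>n. norm ((a n)\<^sup>\<dagger>)))) \<and>
         (bdd_above (range (\<lambda>n. norm ((a n)\<^sup>\<dagger>))) \<longleftrightarrow>
            (\<lambda>n. (a n)\<^sup>\<dagger> * a n) \<longlonglongrightarrow> a'\<^sup>\<dagger> * a' \<and> (\<lambda>n. a n * (a n)\<^sup>\<dagger>) \<longlonglongrightarrow> a' * a'\<^sup>\<dagger>)"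
    (is "(?conv \<longleftrightarrow> ?bdd) \<and> (?bdd \<longleftrightarrow> ?left \<and> ?right)")
proof -
  have MP: "is_MP_inverse (a n) ((a n)\<^sup>\<dagger>)" for n
    using assms(2,3) by (rule is_MP_inverse_MP_inverse)
  have MP': "is_MP_inverse a' (a'\<^sup>\<dagger>)"
    using assms(2,4) by (rule is_MP_inverse_MP_inverse)
  note inv = is_MP_inverse_imp_reflexive_inverse[OF MP] is_MP_inverse_imp_reflexive_inverse[OF MP']
  have bdd_iff: "?bdd \<longleftrightarrow> Bseq (\<lambda>n. (a n)\<^sup>\<dagger>)"
    by (simp add: Bseq_eq_bounded bdd_above_norm[symmetric] image_image)
  have 1: "?conv \<Longrightarrow> ?bdd"
    unfolding bdd_iff by (intro convergent_imp_Bseq convergentI)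
  have 2: "?left \<and> ?right" if ?bdd
  proof -
    have "Bseq (\<lambda>n. (a n)\<^sup>\<dagger>)"
      using that unfolding bdd_iff .
    then show ?thesis
      by (intro conjI left_idempotents_tendsto right_idempotents_tendsto inv assms(2,5)
          is_MP_inverse_idempotents[OF MP] is_MP_inverse_idempotents[OF MP'])
  qed
  have 3: "?left \<and> ?right \<Longrightarrow> ?conv"
    using reflexive_inverses_tendsto[OF inv assms(5)] by blast
  \<comment> \<open>The facts \<open>1\<close>, \<open>2\<close>, \<open>3\<close> form a cycle, so
    each converse is a composition of the other two.\<close>
  have "?conv \<longleftrightarrow> ?bdd"
    by (rule iffI[OF 1 3[OF 2]])
  moreover have "?bdd \<longleftrightarrow> ?left \<and> ?right"
    by (rule iffI[OF 2 1[OF 3]])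
  ultimately show ?thesis
    by (rule conjI)
qed

end
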